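(* Consider an $\mathbf{N}$-player noncooperative game $\mathscr{G}$ in which, given rival decisions $\mathbf{x}^{-i}$, the $i$th player minimizes $f_i(\cdot,\mathbf{x}^{-i})$ over $\mathcal{X}_i$. For $i=1,\dots,\mathbf{N}$, suppose $f_i(\cdot,\mathbf{x}^{-i})$ is convex on $\mathcal{X}_i$ for any $\mathbf{x}^{-i}\in\mathcal{X}_{-i}$. Let $\eta>0$, let $\mathscr{G}_\eta$ be the $\eta$-smoothed game and let $B_{i,\eta}$ be the $\eta$-smoothed proximal best-response maps defined in the context. Let $\mathbf{x}^\eta=(\mathbf{x}^{1,\eta},\dots,\mathbf{x}^{\mathbf{N},\eta})\in\mathcal{X}$. Then: (a) $\mathbf{x}^\eta$ is a fixed point of the smoothed proximal best-response map, i.e. $\mathbf{x}^{i,\eta}=B_{i,\eta}(\mathbf{x}^{\eta})$ for $i=1,\dots,\mathbf{N}$, if and only if $\mathbf{x}^\eta$ is a Nash equilibrium of $\mathscr{G}_\eta$. (b) If $\mathbf{x}^\eta$ is a fixed point of the smoothed proximal best-response map, then $\mathbf{x}^\eta$ is an $\eta\bar\beta$-Nash equilibrium of $\mathscr{G}$, where $\bar\beta=\max_{i\in\{1,\dots,\mathbf{N}\}}\beta_i$.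
   Context: $\mathcal{X}_i\subseteq\mathbb{R}^{n_i}$ are closed convex sets, $\mathcal{X}=\prod_i\mathcal{X}_i$, $\mathcal{X}_{-i}=\prod_{j\ne i}\mathcal{X}_j$. Player $i$'s objective is the implicit function $f_i(\mathbf{x}^i,\mathbf{x}^{-i})=\mathbb{E}[\tilde f_i(\mathbf{x}^i,\mathbf{y}^i(\mathbf{x},\omega),\mathbf{x}^{-i},\omega)]$, where $\mathbf{y}^i(\mathbf{x},\omega)$ is the unique solution of a lower-level parametrized variational inequality $\mathrm{VI}(\mathcal{Y}_i,F_i(\cdot,\mathbf{x},\omega))$ with $F_i(\cdot,\mathbf{x},\omega)$ strongly monotone. Smoothing: for $\eta>0$, $f_{i,\eta}(\mathbf{x}^i,\mathbf{x}^{-i})=\mathbb{E}_{u_i}[f_i(\mathbf{x}^i+\eta u_i,\mathbf{x}^{-i})]$ with $u_i$ uniformly distributed on the unit ball $\mathbb{B}_i\subset\mathbb{R}^{n_i}$ (independent of $\omega$). $\mathscr{G}_\eta$ is the game in which player $i$ minimizes $f_{i,\eta}(\cdot,\mathbf{x}^{-i})$ over $\mathcal{X}_i$. Standing assumption: there is $\mathcal{L}_0$ with $\|\tilde d\|\le\mathcal{L}_0$ for all $\mathbf{x}\in\mathcal{X}$, $\tilde d\in\partial_{\mathbf{x}^i}f_i(\mathbf{x}^i,\mathbf{x}^{-i})$ and all $i$. Standing facts: there exist constants $\alpha_i,\beta_i>0$ such that $f_{i,\eta}(\cdot,\mathbf{x}^{-i})$ is convex with $\tfrac{\alpha_i}{\eta}$-Lipschitz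 gradient on $\mathcal{X}_i$ for every $\mathbf{x}^{-i}\in\mathcal{X}_{-i}$, and $f_i(\mathbf{x})\le f_{i,\eta}(\mathbf{x})\le f_i(\mathbf{x})+\eta\beta_i$ for all $\mathbf{x}\in\mathcal{X}$. Smoothed proximal best-response, for a fixed $c>0$: $B_{i,\eta}(\mathbf{x})=\operatorname{argmin}_{\mathbf{v}^i\in\mathcal{X}_i}\left[f_{i,\eta}(\mathbf{v}^i,\mathbf{x}^{-i})+\tfrac c2\|\mathbf{v}^i-\mathbf{x}^i\|^2\right]$. An $\epsilon$-Nash equilibrium of $\mathscr{G}$ is $\mathbf{x}^*\in\mathcal{X}$ with $f_i(\mathbf{x}^{i,*},\mathbf{x}^{-i,*})\le f_i(\mathbf{x}^i,\mathbf{x}^{-i,*})+\epsilon$ for all $\mathbf{x}^i\in\mathcal{X}_i$ and all $i$; a Nash equilibrium is the case $\epsilon=0$. *)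

theory Defs
  imports "HOL-Probability.Probability"
begin

text \<open>
  The players form a finite type \<open>'p\<close>. Their strategy spaces have different dimensions, which one
  type cannot express directly, so the space of player \<open>i\<close> is the coordinate subspace \<open>span (D i)\<close>
  of a Euclidean space \<open>'a\<close>, where \<open>D i\<close> is a subset of \<open>Basis\<close> with as many elements as the
  dimension. A profile is a function \<open>x :: 'p \<Rightarrow> 'a\<close>. The cost \<open>f i\<close> of player \<open>i\<close> is a function of
  the profile, and \<open>\<lambda>v. f i (x(i := v))\<close> is its dependence on the own strategy, the rivals' strategies
  being those in \<open>x\<close>.
\<close>

definition profiles :: "('p \<Rightarrow> 'a set) \<Rightarrow> ('p \<Rightarrow> 'a) set" where
  "profiles X = Pi UNIV X"


subsection \<open>Lower-level variational inequalities and the implicit objectives\<close>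

definition VI_solution :: "'b::real_inner set \<Rightarrow> ('b \<Rightarrow> 'b) \<Rightarrow> 'b \<Rightarrow> bool" where
  "VI_solution Y G y \<longleftrightarrow> y \<in> Y \<and> (\<forall>z\<in>Y. G y \<bullet> (z - y) \<ge> 0)"

definition strongly_monotone_on :: "'b::real_inner set \<Rightarrow> ('b \<Rightarrow> 'b) \<Rightarrow> bool" where
  "strongly_monotone_on Y G \<longleftrightarrow>
     (\<exists>\<mu>>0. \<forall>y\<in>Y. \<forall>z\<in>Y. (G y - G z) \<bullet> (y - z) \<ge> \<mu> * (norm (y - z))\<^sup>2)"

text \<open>
  \<open>THE\<close> denotes the solution only where it exists and is unique; this has to be assumed separately.
\<close>

definition lower_solution ::
  "('p \<Rightarrow> 'b::real_inner set) \<Rightarrow> ('p \<Rightarrow> 'b \<Rightarrow> ('p \<Rightarrow> 'a) \<Rightarrow> 'w \<Rightarrow> 'b) \<Rightarrow>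
   'p \<Rightarrow> ('p \<Rightarrow> 'a) \<Rightarrow> 'w \<Rightarrow> 'b" where
  "lower_solution Y F i x \<omega> = (THE y. VI_solution (Y i) (\<lambda>y. F i y x \<omega>) y)"

definition implicit_objective ::
  "'w measure \<Rightarrow> ('p \<Rightarrow> 'b::real_inner set) \<Rightarrow> ('p \<Rightarrow> 'b \<Rightarrow> ('p \<Rightarrow> 'a) \<Rightarrow> 'w \<Rightarrow> 'b) \<Rightarrow>
   ('p \<Rightarrow> ('p \<Rightarrow> 'a) \<Rightarrow> 'b \<Rightarrow> 'w \<Rightarrow> real) \<Rightarrow> 'p \<Rightarrow> ('p \<Rightarrow> 'a) \<Rightarrow> real" where
  "implicit_objective M Y F ft i x = (\<integral>\<omega>. ft i x (lower_solution Y F i x \<omega>) \<omega> \<partial>M)"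


subsection \<open>Smoothing over the unit ball\<close>

text \<open>
  Lebesgue measure of the coordinate subspace spanned by \<open>D\<close>, built as \<open>lborel\<close> is from
  one-dimensional Lebesgue measure. (The restriction of \<open>lborel\<close> to a proper subspace would be zero.)
\<close>

definition lborel_span :: "'a::euclidean_space set \<Rightarrow> 'a measure" where
  "lborel_span D = distr (\<Pi>\<^sub>M b\<in>D. lborel) borel (\<lambda>f. \<Sum>b\<in>D. f b *\<^sub>R b)"

lemma lborel_span_Basis: "lborel_span Basis = lborel"
  by (simp add: lborel_span_def lborel_eq[symmetric])

definition uniform_unit_ball :: "'a::euclidean_space set \<Rightarrow> 'a measure" where
  "uniform_unit_ball D = uniform_measure (lborel_span D) (cball 0 1)"

lemma emeasure_lborel_span_cball:
  assumes "D \<subseteq> Basis" "r > 0"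
  shows "emeasure (lborel_span D) (cball 0 r) = ennreal (unit_ball_vol (card D) * r ^ card D)"
proof -
  have fin: "finite D" using assms(1) finite_Basis finite_subset by blast
  have nrm: "norm (\<Sum>b\<in>D. f b *\<^sub>R b) = sqrt (\<Sum>b\<in>D. (f b)\<^sup>2)" for f :: "'a \<Rightarrow> real"
  proof -
    have "(norm (\<Sum>b\<in>D. f b *\<^sub>R b))\<^sup>2 = (\<Sum>b\<in>D. (norm (f b *\<^sub>R b))\<^sup>2)"
      by (rule norm_sum_Pythagorean[OF fin])
        (use assms(1) in \<open>auto simp: pairwise_def orthogonal_def inner_Basis subset_iff\<close>)
    also have "\<dots> = (\<Sum>b\<in>D. (f b)\<^sup>2)"
      using assms(1) by (intro sum.cong) auto
    finally show ?thesis by (simp add: real_sqrt_unique)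
  qed
  have "emeasure (lborel_span D) (cball 0 r) = emeasure (\<Pi>\<^sub>M b\<in>D. lborel)
      ((\<lambda>f. \<Sum>b\<in>D. f b *\<^sub>R b) -` cball 0 r \<inter> space (\<Pi>\<^sub>M b\<in>D. lborel))"
    unfolding lborel_span_def by (rule emeasure_distr) auto
  also have "(\<lambda>f. \<Sum>b\<in>D. f b *\<^sub>R b) -` cball 0 r = {f. sqrt (\<Sum>b\<in>D. (f b)\<^sup>2) \<le> r}"
    by (auto simp: nrm)
  finally show ?thesis using emeasure_cball_aux[OF fin assms(2)] by simp
qed

lemma prob_space_uniform_unit_ball:
  assumes "D \<subseteq> Basis"
  shows "prob_space (uniform_unit_ball D)"
  unfolding uniform_unit_ball_def
  by (rule prob_space_uniform_measure)
    (simp_all add: emeasure_lborel_span_cball[OF assms] unit_ball_vol_pos less_imp_neq[symmetric])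

definition smoothed_objective ::
  "('p \<Rightarrow> 'a::euclidean_space set) \<Rightarrow> real \<Rightarrow> ('p \<Rightarrow> ('p \<Rightarrow> 'a) \<Rightarrow> real) \<Rightarrow>
   'p \<Rightarrow> ('p \<Rightarrow> 'a) \<Rightarrow> real" where
  "smoothed_objective D \<eta> f i x = (\<integral>u. f i (x(i := x i + \<eta> *\<^sub>R u)) \<partial>uniform_unit_ball (D i))"


subsection \<open>Generalized gradients and Lipschitz gradients on a subspace\<close>

text \<open>
  Clarke's generalized directional derivative and generalized gradient of \<open>g\<close>, regarded as a
  function on the subspace \<open>E\<close>.
\<close>

definition clarke_dir_deriv :: "'a::euclidean_space set \<Rightarrow> ('a \<Rightarrow> real) \<Rightarrow> 'a \<Rightarrow> 'a \<Rightarrow> ereal" where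
  "clarke_dir_deriv E g v h =
     Limsup (inf (nhds v) (principal E) \<times>\<^sub>F at_right 0)
       (\<lambda>(w, t). ereal ((g (w + t *\<^sub>R h) - g w) / t))"

definition clarke_subdifferential :: "'a::euclidean_space set \<Rightarrow> ('a \<Rightarrow> real) \<Rightarrow> 'a \<Rightarrow> 'a set" where
  "clarke_subdifferential E g v =
     {d \<in> E. \<forall>h\<in>E. ereal (d \<bullet> h) \<le> clarke_dir_deriv E g v h}"

definition has_lipschitz_gradient_on ::
  "'a::euclidean_space set \<Rightarrow> real \<Rightarrow> 'a set \<Rightarrow> ('a \<Rightarrow> real) \<Rightarrow> bool" where
  "has_lipschitz_gradient_on E L S g \<longleftrightarrow>
     (\<exists>G. (\<forall>v\<in>S. G v \<in> E \<and> (g has_derivative (\<lambda>h. G v \<bullet> h)) (at v within E)) \<and>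
          L-lipschitz_on S G)"


subsection \<open>Equilibria and proximal best responses\<close>

definition eps_nash_equilibrium ::
  "('p \<Rightarrow> 'a set) \<Rightarrow> ('p \<Rightarrow> ('p \<Rightarrow> 'a) \<Rightarrow> real) \<Rightarrow> real \<Rightarrow> ('p \<Rightarrow> 'a) \<Rightarrow> bool" where
  "eps_nash_equilibrium X f \<epsilon> x \<longleftrightarrow>
     x \<in> profiles X \<and> (\<forall>i. \<forall>v\<in>X i. f i x \<le> f i (x(i := v)) + \<epsilon>)"

definition nash_equilibrium ::
  "('p \<Rightarrow> 'a set) \<Rightarrow> ('p \<Rightarrow> ('p \<Rightarrow> 'a) \<Rightarrow> real) \<Rightarrow> ('p \<Rightarrow> 'a) \<Rightarrow> bool" where
  "nash_equilibrium X f x \<longleftrightarrow> eps_nash_equilibrium X f 0 x"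

definition prox_best_response ::
  "('p \<Rightarrow> 'a::euclidean_space set) \<Rightarrow> ('p \<Rightarrow> ('p \<Rightarrow> 'a) \<Rightarrow> real) \<Rightarrow> real \<Rightarrow>
   'p \<Rightarrow> ('p \<Rightarrow> 'a) \<Rightarrow> 'a set" where
  "prox_best_response X f c i x =
     {v. is_arg_min (\<lambda>v. f i (x(i := v)) + c / 2 * (norm (v - x i))\<^sup>2) (\<lambda>v. v \<in> X i) v}"

text \<open>
  The argmin is a set here. That a point equals the argmin means that the set is the singleton of
  that point.
\<close>

definition prox_fixed_point ::
  "('p \<Rightarrow> 'a::euclidean_space set) \<Rightarrow> ('p \<Rightarrow> ('p \<Rightarrow> 'a) \<Rightarrow> real) \<Rightarrow> real \<Rightarrow> ('p \<Rightarrow> 'a) \<Rightarrow> bool" where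
  "prox_fixed_point X f c x \<longleftrightarrow> (\<forall>i. prox_best_response X f c i x = {x i})"

end

theory Submission
  imports Defs
begin

text \<open>
  A minimizer of a cost over a convex set stays the minimizer, and becomes the only one, when a
  proximal term centred at it is added. Conversely, suppose that the centre \<open>x\<close> minimizes the
  regularized cost. Convexity along the segment from \<open>x\<close> to \<open>v\<close> shows that a step of length \<open>t\<close>
  gains \<open>t\<close> times the decrease of the cost from \<open>x\<close> to \<open>v\<close>, whereas the proximal term costs only
  \<open>O(t\<^sup>2)\<close>; letting \<open>t\<close> tend to \<open>0\<close> rules out any decrease. Part (b) combines this with the two-sided
  bound on the smoothing error.
\<close>

lemma prox_center_minimizes:
  fixes g :: "'a::real_inner \<Rightarrow> real"
  assumes g: "convex_on S g" and "x \<in> S" "v \<in> S"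
    and min: "\<And>w. w \<in> S \<Longrightarrow> g x \<le> g w + c / 2 * (norm (w - x))\<^sup>2"
  shows "g x \<le> g v"
proof -
  \<comment> \<open>\<open>q\<close> is the proximal penalty of the full step from \<open>x\<close>
    to \<open>v\<close>; by homogeneity the fraction \<open>t\<close> of that step is charged
    \<open>t * (t * q)\<close>.\<close>
  define q where "q = c / 2 * (norm (v - x))\<^sup>2"
  have le: "g x \<le> g v + t * q" if t: "0 < t" "t < 1" for t
  proof -
    define w where "w = (1 - t) *\<^sub>R x + t *\<^sub>R v"
    have "convex S" using g by (rule convex_on_imp_convex)
    then have "w \<in> S"
      unfolding w_def using assms(2,3) t by (intro convexD) auto
    have gw: "g w \<le> (1 - t) * g x + t * g v"
      unfolding w_def using convex_onD[OF g, of t x v] assms(2,3) t by simp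
    have "w - x = t *\<^sub>R (v - x)"
      by (simp add: w_def algebra_simps)
    then have "c / 2 * (norm (w - x))\<^sup>2 = t * (t * q)"
      using t by (simp add: q_def power2_eq_square)
    \<comment> \<open>The term \<open>(1 - t) * g x\<close> cancels, and dividing by
      \<open>t\<close> leaves the penalty \<open>t * q\<close>, which still vanishes as
      \<open>t\<close> tends to 0.\<close>
    with min[OF \<open>w \<in> S\<close>] gw have "t * g x \<le> t * (g v + t * q)"
      by (simp add: algebra_simps)
    with t show ?thesis by simp
  qed
  have "((\<lambda>t. g v + t * q) \<longlongrightarrow> g v + 0 * q) (at_right 0)"
    by (intro tendsto_intros)
  moreover have "eventually (\<lambda>t. g x \<le> g v + t * q) (at_right (0::real))"
    using le by (intro eventually_at_rightI[of 0 1]) auto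
  ultimately show ?thesis
    by (intro tendsto_lowerbound[of _ "g v" "at_right 0"]) auto
qed

text \<open>The proximal term vanishes at its centre \<open>x i\<close>. Forwards, convexity removes
  the term from the comparison; backwards, \<open>c > 0\<close> makes it strictly positive off the
  centre, so no second minimizer survives.\<close>

lemma prox_best_response_eq_singleton_iff:
  assumes "c > 0" "x i \<in> X i" and conv: "convex_on (X i) (\<lambda>v. f i (x(i := v)))"
  shows "prox_best_response X f c i x = {x i} \<longleftrightarrow> (\<forall>v\<in>X i. f i x \<le> f i (x(i := v)))"
proof
  assume "prox_best_response X f c i x = {x i}"
  then have "x i \<in> prox_best_response X f c i x" by simp
  \<comment> \<open>The trivial update \<open>x(i := x i)\<close> exhibits the left side as the cost
    \<open>\<lambda>v. f i (x(i := v))\<close> at the centre.\<close>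
  then have "f i (x(i := x i)) \<le> f i (x(i := w)) + c / 2 * (norm (w - x i))\<^sup>2" if "w \<in> X i" for w
    using that by (auto simp: prox_best_response_def is_arg_min_linorder)
  then show "\<forall>v\<in>X i. f i x \<le> f i (x(i := v))"
    using prox_center_minimizes[OF conv \<open>x i \<in> X i\<close>, of _ c] unfolding fun_upd_triv by blast
next
  assume min: "\<forall>v\<in>X i. f i x \<le> f i (x(i := v))"
  have "f i x \<le> f i (x(i := v)) + c / 2 * (norm (v - x i))\<^sup>2" if "v \<in> X i" for v
    using min that \<open>c > 0\<close> by (intro order_trans[OF bspec[OF min that]]) simp
  \<comment> \<open>A competing minimizer \<open>v\<close> has regularized cost at most that of the
    centre, \<open>f i x\<close>. As the cost itself cannot drop below \<open>f i x\<close>, the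
    penalty at \<open>v\<close> must be zero.\<close>
  moreover have "v = x i"
    if "v \<in> X i" and le: "f i (x(i := v)) + c / 2 * (norm (v - x i))\<^sup>2 \<le> f i x" for v
  proof -
    have "c / 2 * (norm (v - x i))\<^sup>2 \<le> 0" using bspec[OF min that(1)] le by linarith
    with \<open>c > 0\<close> show ?thesis by (simp add: mult_le_0_iff)
  qed
  ultimately show "prox_best_response X f c i x = {x i}"
    using \<open>x i \<in> X i\<close> by (force simp: prox_best_response_def is_arg_min_linorder)
qed

text \<open>At a fixed point the same profile supplies the rivals' strategies and all proximal
  centres, so the claim splits into one equivalence per player.\<close>

lemma prox_fixed_point_iff_nash:
  assumes "c > 0" "x \<in> profiles X" and "\<And>i. convex_on (X i) (\<lambda>v. f i (x(i := v)))"
  shows "prox_fixed_point X f c x \<longleftrightarrow> nash_equilibrium X f x"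
proof -
  have "x i \<in> X i" for i using assms(2) by (auto simp: profiles_def)
  then show ?thesis
    using assms by (simp add: prox_fixed_point_def nash_equilibrium_def eps_nash_equilibrium_def
        prox_best_response_eq_singleton_iff)
qed

text \<open>The lower bound on \<open>g\<close> is used at \<open>x\<close> and the upper bound at
  the deviation, so the error \<open>\<delta> i\<close> is paid only once: \<open>f i x \<le> g i x
  \<le> g i (x(i := v)) \<le> f i (x(i := v)) + \<delta> i\<close>.\<close>

lemma nash_imp_eps_nash:
  assumes nash: "nash_equilibrium X g x"
    and approx: "\<And>i y. y \<in> profiles X \<Longrightarrow> f i y \<le> g i y \<and> g i y \<le> f i y + \<delta> i"
    and "\<And>i. \<delta> i \<le> \<epsilon>"
  shows "eps_nash_equilibrium X f \<epsilon> x"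
  unfolding eps_nash_equilibrium_def
proof (intro conjI allI ballI)
  show x: "x \<in> profiles X"
    using nash by (simp add: nash_equilibrium_def eps_nash_equilibrium_def)
  fix i v assume v: "v \<in> X i"
  then have "x(i := v) \<in> profiles X" using x by (auto simp: profiles_def)
  moreover have "g i x \<le> g i (x(i := v))"
    using nash v by (simp add: nash_equilibrium_def eps_nash_equilibrium_def)
  ultimately show "f i x \<le> f i (x(i := v)) + \<epsilon>"
    using approx[OF x, of i] approx[of "x(i := v)" i] assms(3)[of i] by linarith
qed

theorem proposition10:
  fixes D X :: "'p::finite \<Rightarrow> 'a::euclidean_space set"
    and Y :: "'p \<Rightarrow> 'b::euclidean_space set"
    and F :: "'p \<Rightarrow> 'b \<Rightarrow> ('p \<Rightarrow> 'a) \<Rightarrow> 'w \<Rightarrow> 'b"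
    and ft :: "'p \<Rightarrow> ('p \<Rightarrow> 'a) \<Rightarrow> 'b \<Rightarrow> 'w \<Rightarrow> real"
    and M :: "'w measure"
    and f f_eta :: "'p \<Rightarrow> ('p \<Rightarrow> 'a) \<Rightarrow> real"
    and \<eta> c L0 :: real
    and \<alpha> \<beta> :: "'p \<Rightarrow> real"
    and x_eta :: "'p \<Rightarrow> 'a"
  assumes strategy_sets:
      "\<And>i. D i \<subseteq> Basis" "\<And>i. X i \<subseteq> span (D i)" "\<And>i. closed (X i)" "\<And>i. convex (X i)"
    and prob: "prob_space M"
    and eta_pos: "\<eta> > 0"
    and c_pos: "c > 0"
    and lower_level:
      "\<And>i x u \<omega>. x \<in> profiles X \<Longrightarrow> u \<in> span (D i) \<inter> cball 0 1 \<Longrightarrow> \<omega> \<in> space M \<Longrightarrow>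
         strongly_monotone_on (Y i) (\<lambda>y. F i y (x(i := x i + \<eta> *\<^sub>R u)) \<omega>)"
      "\<And>i x u \<omega>. x \<in> profiles X \<Longrightarrow> u \<in> span (D i) \<inter> cball 0 1 \<Longrightarrow> \<omega> \<in> space M \<Longrightarrow>
         \<exists>!y. VI_solution (Y i) (\<lambda>y. F i y (x(i := x i + \<eta> *\<^sub>R u)) \<omega>) y"
    and f_def: "f = implicit_objective M Y F ft"
    and f_eta_def: "f_eta = smoothed_objective D \<eta> f"
    and expectations_exist:
      "\<And>i x u. x \<in> profiles X \<Longrightarrow> u \<in> span (D i) \<inter> cball 0 1 \<Longrightarrow>
         integrable M (\<lambda>\<omega>. ft i (x(i := x i + \<eta> *\<^sub>R u))
           (lower_solution Y F i (x(i := x i + \<eta> *\<^sub>R u)) \<omega>) \<omega>)"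
      "\<And>i x. x \<in> profiles X \<Longrightarrow>
         integrable (uniform_unit_ball (D i)) (\<lambda>u. f i (x(i := x i + \<eta> *\<^sub>R u)))"
    and subgradient_bound:
      "\<And>i x d. x \<in> profiles X \<Longrightarrow>
         d \<in> clarke_subdifferential (span (D i)) (\<lambda>v. f i (x(i := v))) (x i) \<Longrightarrow> norm d \<le> L0"
    and constants_pos: "\<And>i. \<alpha> i > 0" "\<And>i. \<beta> i > 0"
    and smoothed_convex:
      "\<And>i x. x \<in> profiles X \<Longrightarrow> convex_on (X i) (\<lambda>v. f_eta i (x(i := v)))"
    and smoothed_gradient:
      "\<And>i x. x \<in> profiles X \<Longrightarrow>
         has_lipschitz_gradient_on (span (D i)) (\<alpha> i / \<eta>) (X i) (\<lambda>v. f_eta i (x(i := v)))"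
    and smoothing_error:
      "\<And>i x. x \<in> profiles X \<Longrightarrow> f i x \<le> f_eta i x \<and> f_eta i x \<le> f i x + \<eta> * \<beta> i"
    and f_convex:
      "\<And>i x. x \<in> profiles X \<Longrightarrow> convex_on (X i) (\<lambda>v. f i (x(i := v)))"
    and x_eta: "x_eta \<in> profiles X"
  shows "(prox_fixed_point X f_eta c x_eta \<longleftrightarrow> nash_equilibrium X f_eta x_eta) \<and>
         (prox_fixed_point X f_eta c x_eta \<longrightarrow>
            eps_nash_equilibrium X f (\<eta> * Max (range \<beta>)) x_eta)"
proof -
  have iff: "prox_fixed_point X f_eta c x_eta \<longleftrightarrow> nash_equilibrium X f_eta x_eta"
    by (rule prox_fixed_point_iff_nash[OF c_pos x_eta smoothed_convex[OF x_eta]])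
  \<comment> \<open>A single tolerance has to serve all players; the maximum bounds each
    \<open>\<beta> i\<close> because there are finitely many of them.\<close>
  have "\<eta> * \<beta> i \<le> \<eta> * Max (range \<beta>)" for i
    using eta_pos by (intro mult_left_mono) auto
  then have "eps_nash_equilibrium X f (\<eta> * Max (range \<beta>)) x_eta" if "nash_equilibrium X f_eta x_eta"
    using nash_imp_eps_nash[OF that, of f "\<lambda>i. \<eta> * \<beta> i"] smoothing_error by blast
  with iff show ?thesis by blast
qed

end
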